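(* For a commutative ring $R$ the following three statements are equivalent: (1) The ring $R$ is a $Z_2$ ring, i.e., for each $A\in Um(\mathbb{M}_2(R))$ there exists $B\in Um(\mathbb{M}_2(R))$ congruent to $A$ modulo $R\det(A)$ and with $\det(B)=0$. (2) For each matrix $A\in Um(\mathbb{M}_2(R))$ there exists a matrix $C\in Um(\mathbb{M}_2(R))$ such that $A+\det(A)C\in Um(\mathbb{M}_2(R))$ and moreover $\det(C)=\det(A+\det(A)C)=0$. (3) For each matrix $A\in \mathbb{M}_2(R)$ there exists a matrix $C\in Um(\mathbb{M}_2(R))$ such that $A+\det(A)C\in Um(\mathbb{M}_2(R))$ and moreover $\det(C)=\det(A+\det(A)C)=0$. Moreover, these three statements are implied by the following fourth one: (4) For each nonzero $a\in R$, the map of sets $$\{A\in Um(\mathbb{M}_2(R))\mid\det(A)=0\}\rightarrow\{\bar A\in Um(\mathbb{M}_2(R/Ra))\mid\det(\bar A)=0\},$$ defined by the reduction modulo $Ra$, is surjective. If $sr(R)\le 4$, then these four statements are equivalent.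
   Context: Rings are commutative with identity. $\mathbb{M}_2(R)$ is the ring of $2\times 2$ matrices with entries in $R$. $A\in Um(\mathbb{M}_2(R))$ (unimodular) means that the entries of $A\in\mathbb{M}_2(R)$ generate the unit ideal of $R$; similarly $Um(R^n)$ is the set of $n$-tuples generating the unit ideal. Two matrices are congruent modulo an ideal $I$ if all entries of their difference lie in $I$. The stable range $sr(R)$ is the smallest $n\in\mathbb{N}=\{1,2,\dots\}$ such that for each $(a_1,\ldots,a_n,b)\in Um(R^{n+1})$ there exists $(r_1,\ldots,r_n)\in R^n$ with $(a_1+br_1,\ldots,a_n+br_n)\in Um(R^n)$ (and $sr(R)=\infty$ if there is no such $n$).
   Formalization: Statement (3) is false as written in every nonzero ring (take A = 0); it is replaced by: for each A in Um(M_2(R)) there exists C in M_2(R), not required unimodular, with A+det(A)C in Um(M_2(R)) and det(C)=det(A+det(A)C)=0. *)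

theory Defs
  imports "HOL-Algebra.Algebra" "HOL-Library.Extended_Nat"
begin

text \<open>
  Everything is relative to an HOL-Algebra ring record, because the quotients \<open>R Quot PIdl a\<close>
  are needed for varying \<open>a\<close>, and because \<^locale>\<open>cring\<close> admits the zero ring.
\<close>

text \<open>
  \<open>Mat2 a b c d\<close> has first row \<open>a, b\<close> and second row \<open>c, d\<close>. Of the constants generated by the
  datatype package, \<open>set_mat2\<close> is the set of entries, \<open>map_mat2\<close> acts entrywise, and \<open>rel_mat2\<close>
  relates matrices entrywise.
\<close>

datatype 'a mat2 = Mat2 'a 'a 'a 'a

definition matrices2 :: "('a, 'm) ring_scheme \<Rightarrow> 'a mat2 set" where
  "matrices2 R = {A. set_mat2 A \<subseteq> carrier R}"

fun det2 :: "('a, 'm) ring_scheme \<Rightarrow> 'a mat2 \<Rightarrow> 'a" where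
  "det2 R (Mat2 a b c d) = a \<otimes>\<^bsub>R\<^esub> d \<ominus>\<^bsub>R\<^esub> b \<otimes>\<^bsub>R\<^esub> c"

fun add2 :: "('a, 'm) ring_scheme \<Rightarrow> 'a mat2 \<Rightarrow> 'a mat2 \<Rightarrow> 'a mat2" where
  "add2 R (Mat2 a b c d) (Mat2 a' b' c' d') =
     Mat2 (a \<oplus>\<^bsub>R\<^esub> a') (b \<oplus>\<^bsub>R\<^esub> b') (c \<oplus>\<^bsub>R\<^esub> c') (d \<oplus>\<^bsub>R\<^esub> d')"

definition smult2 :: "('a, 'm) ring_scheme \<Rightarrow> 'a \<Rightarrow> 'a mat2 \<Rightarrow> 'a mat2" where
  "smult2 R r A = map_mat2 (\<lambda>x. r \<otimes>\<^bsub>R\<^esub> x) A"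

definition generates_unit_ideal :: "('a, 'm) ring_scheme \<Rightarrow> 'a set \<Rightarrow> bool" where
  "generates_unit_ideal R S \<longleftrightarrow> S \<subseteq> carrier R \<and> genideal R S = carrier R"

definition Um_mat2 :: "('a, 'm) ring_scheme \<Rightarrow> 'a mat2 set" where
  "Um_mat2 R = {A \<in> matrices2 R. generates_unit_ideal R (set_mat2 A)}"

definition Um_tuples :: "('a, 'm) ring_scheme \<Rightarrow> nat \<Rightarrow> 'a list set" where
  "Um_tuples R n = {xs. length xs = n \<and> generates_unit_ideal R (set xs)}"

definition cong_mod2 :: "('a, 'm) ring_scheme \<Rightarrow> 'a set \<Rightarrow> 'a mat2 \<Rightarrow> 'a mat2 \<Rightarrow> bool" where
  "cong_mod2 R I A B \<longleftrightarrow> rel_mat2 (\<lambda>x y. x \<ominus>\<^bsub>R\<^esub> y \<in> I) A B"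

definition Z2_ring :: "('a, 'm) ring_scheme \<Rightarrow> bool" where
  "Z2_ring R \<longleftrightarrow>
     (\<forall>A \<in> Um_mat2 R. \<exists>B \<in> Um_mat2 R.
        cong_mod2 R (cgenideal R (det2 R A)) B A \<and> det2 R B = \<zero>\<^bsub>R\<^esub>)"

text \<open>The infimum of the empty set in \<^typ>\<open>enat\<close> is \<open>\<infinity>\<close>.\<close>

definition stable_range :: "('a, 'm) ring_scheme \<Rightarrow> enat" where
  "stable_range R = Inf (enat ` {n. n \<ge> 1 \<and>
     (\<forall>as b. as @ [b] \<in> Um_tuples R (n + 1) \<longrightarrow>
        (\<exists>rs. length rs = n \<and> set rs \<subseteq> carrier R \<and>
           map2 (\<lambda>a r. a \<oplus>\<^bsub>R\<^esub> b \<otimes>\<^bsub>R\<^esub> r) as rs \<in> Um_tuples R n))})"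

definition reduce2 :: "('a, 'm) ring_scheme \<Rightarrow> 'a \<Rightarrow> 'a mat2 \<Rightarrow> 'a set mat2" where
  "reduce2 R a A = map_mat2 (\<lambda>x. cgenideal R a +>\<^bsub>R\<^esub> x) A"

definition Um_det_zero :: "('a, 'm) ring_scheme \<Rightarrow> 'a mat2 set" where
  "Um_det_zero R = {A \<in> Um_mat2 R. det2 R A = \<zero>\<^bsub>R\<^esub>}"

lemma (in cring) not_unimodular_shift_of_all_matrices:
  \<comment> \<open>For \<open>A = 0\<close> one has \<open>A + det(A)C = 0\<close>. Hence a condition asking for \<open>A + det(A)C\<close> to be
     unimodular can be imposed on unimodular \<open>A\<close> only: on all of \<open>M\<^sub>2(R)\<close> it fails in every nonzero
     ring, and so cannot characterise \<open>Z\<^sub>2\<close> rings.\<close>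
  assumes "\<one> \<noteq> \<zero>"
  shows "\<not> (\<forall>A \<in> matrices2 R. \<exists>C \<in> matrices2 R. add2 R A (smult2 R (det2 R A) C) \<in> Um_mat2 R)"
proof
  define O2 where "O2 = Mat2 \<zero> \<zero> \<zero> \<zero>"
  assume "\<forall>A \<in> matrices2 R. \<exists>C \<in> matrices2 R. add2 R A (smult2 R (det2 R A) C) \<in> Um_mat2 R"
  moreover have "O2 \<in> matrices2 R"
    by (simp add: O2_def matrices2_def)
  ultimately obtain C where C: "C \<in> matrices2 R"
    and U: "add2 R O2 (smult2 R (det2 R O2) C) \<in> Um_mat2 R"
    by blast
  have "det2 R O2 = \<zero>"
    unfolding O2_def by (simp only: det2.simps l_null zero_closed r_neg a_minus_def minus_zero l_zero)
  moreover have "set_mat2 C \<subseteq> carrier R"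
    using C by (simp add: matrices2_def)
  ultimately have "add2 R O2 (smult2 R (det2 R O2) C) = O2"
    by (cases C) (simp add: O2_def smult2_def del: det2.simps)
  with U have "Idl {\<zero>} = carrier R"
    by (simp add: O2_def Um_mat2_def generates_unit_ideal_def)
  then show False
    using assms genideal_zero one_closed by auto
qed

end

theory Submission
  imports Defs
begin

text \<open>
  Write \<open>\<langle>A, C\<rangle> = tr(adj(A)C)\<close> for the polar form of the determinant, so that \<open>A\<close> is unimodular iff
  \<open>\<langle>A, T\<rangle> = 1\<close> for some \<open>T\<close>, and \<open>det(A + kC) = det A + k\<langle>A, C\<rangle> + k\<^sup>2 det C\<close>. If \<open>det C = 0\<close> and
  \<open>\<langle>A, C\<rangle> = -1\<close>, then \<open>A + det(A)C\<close> has determinant \<open>0\<close> and pairs to \<open>-1\<close> with \<open>C\<close>, hence both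
  matrices are unimodular. Such a \<open>C\<close> is obtained from a unimodular \<open>B = A + det(A)C\<^sub>0\<close> with
  \<open>det B = 0\<close>: complete \<open>B\<close> to a hyperbolic pair \<open>B, T\<close> and multiply a multiple of \<open>T\<close> plus \<open>C\<^sub>0\<close> from
  the right by the rank one idempotent \<open>adj(B)T\<close>.

  For the lifting property, stable range at most \<open>4\<close> lifts a unimodular matrix over \<open>R/Ra\<close> to a
  unimodular matrix over \<open>R\<close>; its determinant lies in \<open>Ra\<close> if the determinant over \<open>R/Ra\<close> is zero,
  so that the \<open>Z\<^sub>2\<close> property corrects it modulo \<open>Ra\<close>.
\<close>

section \<open>Subtraction in ring identities\<close>

context cring
begin

lemma minus_add_left: "\<lbrakk>p \<in> carrier R; q \<in> carrier R; r \<in> carrier R\<rbrakk> \<Longrightarrow> (p \<ominus> q) \<oplus> r = (p \<oplus> r) \<ominus> q"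
  by (simp add: a_minus_def a_ac)

lemma minus_add_right: "\<lbrakk>p \<in> carrier R; q \<in> carrier R; r \<in> carrier R\<rbrakk> \<Longrightarrow> r \<oplus> (p \<ominus> q) = (r \<oplus> p) \<ominus> q"
  by (simp add: a_minus_def a_ac)

lemma minus_minus_left: "\<lbrakk>p \<in> carrier R; q \<in> carrier R; r \<in> carrier R\<rbrakk> \<Longrightarrow> (p \<ominus> q) \<ominus> r = p \<ominus> (q \<oplus> r)"
  by (simp add: a_minus_def a_ac minus_add)

lemma minus_minus_right: "\<lbrakk>p \<in> carrier R; q \<in> carrier R; r \<in> carrier R\<rbrakk> \<Longrightarrow> r \<ominus> (p \<ominus> q) = (r \<oplus> q) \<ominus> p"
  by (simp add: a_minus_def a_ac minus_add)

lemma uminus_eq_zero_minus: "p \<in> carrier R \<Longrightarrow> \<ominus> p = \<zero> \<ominus> p"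
  by (simp add: a_minus_def)

lemma minus_mult_left: "\<lbrakk>p \<in> carrier R; q \<in> carrier R; r \<in> carrier R\<rbrakk> \<Longrightarrow> (p \<ominus> q) \<otimes> r = p \<otimes> r \<ominus> q \<otimes> r"
  by (simp add: a_minus_def l_distr l_minus)

lemma minus_mult_right: "\<lbrakk>p \<in> carrier R; q \<in> carrier R; r \<in> carrier R\<rbrakk> \<Longrightarrow> r \<otimes> (p \<ominus> q) = r \<otimes> p \<ominus> r \<otimes> q"
  by (simp add: a_minus_def r_distr r_minus)

lemma minus_eq_iff: "\<lbrakk>p \<in> carrier R; q \<in> carrier R; r \<in> carrier R\<rbrakk> \<Longrightarrow> p \<ominus> q = r \<longleftrightarrow> p = r \<oplus> q"
  by (metis a_minus_def add.inv_solve_right minus_closed)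

lemma eq_minus_iff: "\<lbrakk>p \<in> carrier R; q \<in> carrier R; r \<in> carrier R\<rbrakk> \<Longrightarrow> r = p \<ominus> q \<longleftrightarrow> r \<oplus> q = p"
  using minus_eq_iff by metis

text \<open>
  Rewriting both sides of a ring identity to differences of subtraction-free terms and clearing the
  differences leaves a semiring identity, which expansion and commutativity decide.
\<close>

lemmas difference_simps = minus_add_left minus_add_right minus_minus_left minus_minus_right
  uminus_eq_zero_minus minus_mult_left minus_mult_right minus_eq_iff eq_minus_iff

lemmas expand_simps = difference_simps l_distr r_distr a_ac m_ac

end

section \<open>The determinant, its polar form and products of matrices\<close>

fun polar2 :: "('a, 'm) ring_scheme \<Rightarrow> 'a mat2 \<Rightarrow> 'a mat2 \<Rightarrow> 'a" where
  "polar2 R (Mat2 a b c d) (Mat2 a' b' c' d') =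
     (a \<otimes>\<^bsub>R\<^esub> d' \<oplus>\<^bsub>R\<^esub> d \<otimes>\<^bsub>R\<^esub> a') \<ominus>\<^bsub>R\<^esub> (b \<otimes>\<^bsub>R\<^esub> c' \<oplus>\<^bsub>R\<^esub> c \<otimes>\<^bsub>R\<^esub> b')"

fun mult2 :: "('a, 'm) ring_scheme \<Rightarrow> 'a mat2 \<Rightarrow> 'a mat2 \<Rightarrow> 'a mat2" where
  "mult2 R (Mat2 a b c d) (Mat2 a' b' c' d') =
     Mat2 (a \<otimes>\<^bsub>R\<^esub> a' \<oplus>\<^bsub>R\<^esub> b \<otimes>\<^bsub>R\<^esub> c') (a \<otimes>\<^bsub>R\<^esub> b' \<oplus>\<^bsub>R\<^esub> b \<otimes>\<^bsub>R\<^esub> d')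
          (c \<otimes>\<^bsub>R\<^esub> a' \<oplus>\<^bsub>R\<^esub> d \<otimes>\<^bsub>R\<^esub> c') (c \<otimes>\<^bsub>R\<^esub> b' \<oplus>\<^bsub>R\<^esub> d \<otimes>\<^bsub>R\<^esub> d')"

lemma Mat2_in_matrices2 [simp]:
  "Mat2 a b c d \<in> matrices2 R \<longleftrightarrow>
     a \<in> carrier R \<and> b \<in> carrier R \<and> c \<in> carrier R \<and> d \<in> carrier R"
  by (auto simp: matrices2_def)

lemma smult2_Mat2 [simp]:
  "smult2 R r (Mat2 a b c d) = Mat2 (r \<otimes>\<^bsub>R\<^esub> a) (r \<otimes>\<^bsub>R\<^esub> b) (r \<otimes>\<^bsub>R\<^esub> c) (r \<otimes>\<^bsub>R\<^esub> d)"
  by (simp add: smult2_def)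

context cring
begin

lemma det2_closed [simp]: "A \<in> matrices2 R \<Longrightarrow> det2 R A \<in> carrier R"
  by (cases A) simp

lemma polar2_closed [simp]: "\<lbrakk>A \<in> matrices2 R; B \<in> matrices2 R\<rbrakk> \<Longrightarrow> polar2 R A B \<in> carrier R"
  by (cases A; cases B) simp

lemma add2_closed [simp]: "\<lbrakk>A \<in> matrices2 R; B \<in> matrices2 R\<rbrakk> \<Longrightarrow> add2 R A B \<in> matrices2 R"
  by (cases A; cases B) simp

lemma smult2_closed [simp]: "\<lbrakk>r \<in> carrier R; A \<in> matrices2 R\<rbrakk> \<Longrightarrow> smult2 R r A \<in> matrices2 R"
  by (cases A) simp

lemma mult2_closed [simp]: "\<lbrakk>A \<in> matrices2 R; B \<in> matrices2 R\<rbrakk> \<Longrightarrow> mult2 R A B \<in> matrices2 R"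
  by (cases A; cases B) simp

lemma polar2_commute: "\<lbrakk>A \<in> matrices2 R; B \<in> matrices2 R\<rbrakk> \<Longrightarrow> polar2 R A B = polar2 R B A"
  by (cases A; cases B) (simp add: a_ac m_ac)

lemma polar2_self: "A \<in> matrices2 R \<Longrightarrow> polar2 R A A = det2 R A \<oplus> det2 R A"
  by (cases A) (simp add: expand_simps)

lemma polar2_add_smult:
  "\<lbrakk>A \<in> matrices2 R; D \<in> matrices2 R; E \<in> matrices2 R; k \<in> carrier R\<rbrakk> \<Longrightarrow>
     polar2 R A (add2 R D (smult2 R k E)) = polar2 R A D \<oplus> k \<otimes> polar2 R A E"
  by (cases A; cases D; cases E) (simp add: expand_simps)

lemma det2_add_smult:
  "\<lbrakk>A \<in> matrices2 R; C \<in> matrices2 R; k \<in> carrier R\<rbrakk> \<Longrightarrow>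
     det2 R (add2 R A (smult2 R k C)) = det2 R A \<oplus> k \<otimes> polar2 R A C \<oplus> k \<otimes> k \<otimes> det2 R C"
  by (cases A; cases C) (simp add: expand_simps)

lemma det2_mult2:
  "\<lbrakk>A \<in> matrices2 R; F \<in> matrices2 R\<rbrakk> \<Longrightarrow> det2 R (mult2 R A F) = det2 R A \<otimes> det2 R F"
  by (cases A; cases F) (simp add: expand_simps)

text \<open>This polarises the multiplicativity of the determinant. If \<open>det F = 0\<close>,
  right multiples by \<open>F\<close> are therefore orthogonal to each other.\<close>

lemma polar2_mult2:
  "\<lbrakk>A \<in> matrices2 R; B \<in> matrices2 R; F \<in> matrices2 R\<rbrakk> \<Longrightarrow>
     polar2 R (mult2 R A F) (mult2 R B F) = polar2 R A B \<otimes> det2 R F"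
  by (cases A; cases B; cases F) (simp add: expand_simps)

text \<open>With \<open>C = C\<^sub>0F\<close> one has \<open>A + kC = A(1 - F)\<close>, and \<open>1 - F\<close> has determinant \<open>1 - tr F + det F\<close>.\<close>

lemma det2_add_smult_mult2:
  assumes A: "A \<in> matrices2 R" and C: "C \<in> matrices2 R" and k: "k \<in> carrier R"
    and F: "F \<in> matrices2 R" "det2 R F = \<zero>" "polar2 R (Mat2 \<one> \<zero> \<zero> \<one>) F = \<one>"
    and 0: "mult2 R (add2 R A (smult2 R k C)) F = Mat2 \<zero> \<zero> \<zero> \<zero>"
  shows "det2 R (add2 R A (smult2 R k (mult2 R C F))) = \<zero>"
proof -
  define G where "G = add2 R (Mat2 \<one> \<zero> \<zero> \<one>) (smult2 R (\<ominus> \<one>) F)"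
  have G: "G \<in> matrices2 R"
    using F by (simp add: G_def)
  have "add2 R A (smult2 R k (mult2 R C F)) =
      add2 R (mult2 R A G) (mult2 R (add2 R A (smult2 R k C)) F)"
    using A C k F(1) unfolding G_def
    by (cases A; cases C; cases F) (simp add: expand_simps)
  also have "\<dots> = mult2 R A G"
    using mult2_closed[OF A G] unfolding 0 by (cases "mult2 R A G") simp
  finally have "det2 R (add2 R A (smult2 R k (mult2 R C F))) = det2 R A \<otimes> det2 R G"
    using A G by (simp add: det2_mult2)
  moreover have "det2 R G = \<zero>"
    using F unfolding G_def by (subst det2_add_smult) (simp_all add: expand_simps)
  ultimately show ?thesis
    using A by simp
qed

text \<open>The witness is the idempotent \<open>F = adj(B)T\<close>.\<close>

lemma hyperbolic_pair_projection:
  assumes "B \<in> matrices2 R" "T \<in> matrices2 R"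
    and "det2 R B = \<zero>" "det2 R T = \<zero>" "polar2 R B T = \<one>"
  obtains F where "F \<in> matrices2 R" "det2 R F = \<zero>" "polar2 R (Mat2 \<one> \<zero> \<zero> \<one>) F = \<one>"
    "mult2 R B F = Mat2 \<zero> \<zero> \<zero> \<zero>" "mult2 R T F = T"
proof -
  obtain x y z w where B: "B = Mat2 x y z w" by (cases B)
  obtain p q r s where T: "T = Mat2 p q r s" by (cases T)
  have [simp]: "x \<in> carrier R" "y \<in> carrier R" "z \<in> carrier R" "w \<in> carrier R"
    "p \<in> carrier R" "q \<in> carrier R" "r \<in> carrier R" "s \<in> carrier R"
    using assms by (simp_all add: B T)
  define adjB where "adjB = Mat2 w (\<ominus> y) (\<ominus> z) x"
  define F where "F = mult2 R adjB T"
  have adjB: "adjB \<in> matrices2 R"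
    by (simp add: adjB_def)
  have "det2 R F = \<zero>"
    using assms(2,4) adjB by (simp add: F_def det2_mult2)
  \<comment> \<open>Pairing with the identity matrix is the trace, and \<open>tr(adj(B)T)\<close> is
    the polar form of \<open>B\<close> and \<open>T\<close>.\<close>
  moreover have "polar2 R (Mat2 \<one> \<zero> \<zero> \<one>) F = polar2 R B T"
    by (simp add: F_def adjB_def B T expand_simps)
  \<comment> \<open>Here \<open>B adj(B) = det(B)\<close> is multiplied by \<open>T\<close> from the
    right.\<close>
  moreover have "mult2 R B F = smult2 R (det2 R B) T"
    by (simp add: F_def adjB_def B T expand_simps)
  \<comment> \<open>Polarising \<open>X adj(X) = det(X)\<close> gives that
    \<open>T adj(B) + B adj(T)\<close> is the scalar \<open>\<langle>B, T\<rangle>\<close>; multiply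
    by \<open>T\<close> from the right.\<close>
  moreover have "add2 R (mult2 R T F) (smult2 R (det2 R T) B) = smult2 R (polar2 R B T) T"
    by (simp add: F_def adjB_def B T expand_simps)
  moreover have "F \<in> matrices2 R"
    using assms(2) adjB by (simp add: F_def)
  ultimately have F: "F \<in> matrices2 R" "det2 R F = \<zero>" "polar2 R (Mat2 \<one> \<zero> \<zero> \<one>) F = \<one>"
    "mult2 R B F = smult2 R \<zero> T"
    "add2 R (mult2 R T F) (smult2 R \<zero> B) = smult2 R \<one> T"
    using assms by simp_all
  obtain t1 t2 t3 t4 where TF: "mult2 R T F = Mat2 t1 t2 t3 t4" by (cases "mult2 R T F")
  moreover have "mult2 R T F \<in> matrices2 R"
    using assms(2) F(1) by simp
  ultimately have "mult2 R T F = T"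
    using F(5) by (simp add: B T)
  moreover have "mult2 R B F = Mat2 \<zero> \<zero> \<zero> \<zero>"
    using F(4) by (simp add: T)
  ultimately show thesis
    using that F(1-3) by blast
qed

section \<open>Finitely generated unit ideals and unimodularity\<close>

lemma mem_genideal_insert_iff:
  assumes a: "a \<in> carrier R" and S: "S \<subseteq> carrier R"
  shows "x \<in> Idl (insert a S) \<longleftrightarrow> (\<exists>r \<in> carrier R. \<exists>y \<in> Idl S. x = r \<otimes> a \<oplus> y)"
proof
  interpret I: ideal "Idl (insert a S)" R
    using a S by (intro genideal_ideal) auto
  have gen: "a \<in> Idl (insert a S)" "Idl S \<subseteq> Idl (insert a S)"
    using a S genideal_self[of "insert a S"] subset_Idl_subset[of "insert a S" S] by auto
  show "x \<in> Idl (insert a S)" if "\<exists>r \<in> carrier R. \<exists>y \<in> Idl S. x = r \<otimes> a \<oplus> y"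
    using that gen by (auto intro!: I.a_closed I.I_l_closed)
  have S_ideal: "ideal (Idl S) R"
    using S by (rule genideal_ideal)
  \<comment> \<open>The linear combinations in question form the sum of two ideals, so minimality of
    the generated ideal gives the converse inclusion.\<close>
  have J: "ideal (PIdl a <+>\<^bsub>R\<^esub> Idl S) R"
    using a S_ideal by (intro add_ideals cgenideal_ideal)
  have "insert a S \<subseteq> PIdl a <+>\<^bsub>R\<^esub> Idl S"
  proof -
    have "a \<in> PIdl a <+>\<^bsub>R\<^esub> Idl S"
      unfolding set_add_def' using cgenideal_self[OF a] additive_subgroup.zero_closed[OF ideal.axioms(1)[OF S_ideal]]
        r_zero[OF a] by force
    moreover have "s \<in> PIdl a <+>\<^bsub>R\<^esub> Idl S" if "s \<in> S" for s
      unfolding set_add_def' using that genideal_self[OF S]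
        additive_subgroup.zero_closed[OF ideal.axioms(1)[OF cgenideal_ideal[OF a]]] S by force
    ultimately show ?thesis
      by blast
  qed
  then have "Idl (insert a S) \<subseteq> PIdl a <+>\<^bsub>R\<^esub> Idl S"
    using J by (intro genideal_minimal)
  then show "\<exists>r \<in> carrier R. \<exists>y \<in> Idl S. x = r \<otimes> a \<oplus> y" if "x \<in> Idl (insert a S)"
    using that unfolding set_add_def' cgenideal_def by blast
qed

lemma genideal_empty: "Idl {} = {\<zero>}"
  using genideal_minimal[OF zeroideal, of "{}"]
    additive_subgroup.zero_closed[OF ideal.axioms(1)[OF genideal_ideal[of "{}"]]] by auto

lemma generates_unit_ideal_iff:
  "generates_unit_ideal R S \<longleftrightarrow> S \<subseteq> carrier R \<and> \<one> \<in> Idl S"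
  unfolding generates_unit_ideal_def
  using ideal.one_imp_carrier[OF genideal_ideal[of S]] by auto

text \<open>The polar form is a perfect pairing: it is the dot product of the entries of
  \<open>A\<close> with those of \<open>T\<close>, up to order and sign. This replaces ideals by a
  single equation.\<close>

lemma Um_mat2_iff:
  "A \<in> Um_mat2 R \<longleftrightarrow> A \<in> matrices2 R \<and> (\<exists>T \<in> matrices2 R. polar2 R A T = \<one>)"
proof -
  obtain a b c d where A: "A = Mat2 a b c d" by (cases A)
  have "\<one> \<in> Idl {a, b, c, d} \<longleftrightarrow> (\<exists>T \<in> matrices2 R. polar2 R A T = \<one>)" if "A \<in> matrices2 R"
  proof -
    have [simp]: "a \<in> carrier R" "b \<in> carrier R" "c \<in> carrier R" "d \<in> carrier R"
      using that by (simp_all add: A)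
    have "\<one> \<in> Idl {a, b, c, d} \<longleftrightarrow> (\<exists>r \<in> carrier R. \<exists>s \<in> carrier R. \<exists>t \<in> carrier R. \<exists>u \<in> carrier R.
        \<one> = r \<otimes> a \<oplus> (s \<otimes> b \<oplus> (t \<otimes> c \<oplus> u \<otimes> d)))"
      by (simp add: mem_genideal_insert_iff genideal_empty Bex_def) (metis m_closed r_zero)
    also have "\<dots> \<longleftrightarrow> (\<exists>T \<in> matrices2 R. polar2 R A T = \<one>)"
    proof
      assume "\<exists>r \<in> carrier R. \<exists>s \<in> carrier R. \<exists>t \<in> carrier R. \<exists>u \<in> carrier R.
        \<one> = r \<otimes> a \<oplus> (s \<otimes> b \<oplus> (t \<otimes> c \<oplus> u \<otimes> d))"
      then obtain r s t u where *: "r \<in> carrier R" "s \<in> carrier R" "t \<in> carrier R" "u \<in> carrier R"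
        "\<one> = r \<otimes> a \<oplus> (s \<otimes> b \<oplus> (t \<otimes> c \<oplus> u \<otimes> d))" by blast
      \<comment> \<open>The witness is the adjugate of the transposed matrix of
        coefficients.\<close>
      then have "polar2 R A (Mat2 u (\<ominus> t) (\<ominus> s) r) = \<one>"
        unfolding *(5) A by (simp add: expand_simps)
      then show "\<exists>T \<in> matrices2 R. polar2 R A T = \<one>"
        using * by (intro bexI[of _ "Mat2 u (\<ominus> t) (\<ominus> s) r"]) auto
    next
      assume "\<exists>T \<in> matrices2 R. polar2 R A T = \<one>"
      then obtain T where T: "T \<in> matrices2 R" "polar2 R A T = \<one>" by blast
      obtain r s t u where Teq: "T = Mat2 r s t u" by (cases T)
      have *: "r \<in> carrier R" "s \<in> carrier R" "t \<in> carrier R" "u \<in> carrier R"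
        using T by (simp_all add: Teq)
      have "\<one> = u \<otimes> a \<oplus> ((\<ominus> t) \<otimes> b \<oplus> ((\<ominus> s) \<otimes> c \<oplus> r \<otimes> d))"
        using * unfolding T(2)[symmetric] A Teq by (simp add: expand_simps)
      then show "\<exists>r \<in> carrier R. \<exists>s \<in> carrier R. \<exists>t \<in> carrier R. \<exists>u \<in> carrier R.
        \<one> = r \<otimes> a \<oplus> (s \<otimes> b \<oplus> (t \<otimes> c \<oplus> u \<otimes> d))"
        using * by blast
    qed
    finally show ?thesis .
  qed
  then show ?thesis
    by (auto simp: Um_mat2_def generates_unit_ideal_iff matrices2_def A)
qed

section \<open>Isotropic matrices pairing to \<open>-1\<close> with a given matrix\<close>

text \<open>
  For \<open>B = A + det(A)C\<^sub>0\<close> and a hyperbolic pair \<open>B, T\<close> with projection \<open>F\<close>, the matrix \<open>C\<^sub>0F\<close>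
  works up to the error \<open>h = 1 + \<langle>A, C\<^sub>0F\<rangle>\<close>, which is killed by \<open>det A\<close>. Subtracting \<open>hT = hTF\<close>
  removes the error.
\<close>

lemma simple_extension_exists:
  assumes A: "A \<in> matrices2 R" and C0: "C0 \<in> matrices2 R"
    and B: "add2 R A (smult2 R (det2 R A) C0) \<in> Um_mat2 R"
      "det2 R (add2 R A (smult2 R (det2 R A) C0)) = \<zero>"
  obtains C where "C \<in> matrices2 R" "det2 R C = \<zero>" "polar2 R A C = \<ominus> \<one>"
proof -
  define d where "d = det2 R A"
  define B where "B = add2 R A (smult2 R d C0)"
  have d: "d \<in> carrier R" and BM: "B \<in> matrices2 R"
    using A C0 by (simp_all add: d_def B_def)
  have detB: "det2 R B = \<zero>"
    using assms by (simp add: B_def d_def)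
  obtain T0 where T0: "T0 \<in> matrices2 R" "polar2 R B T0 = \<one>"
    using B by (auto simp: Um_mat2_iff B_def d_def)
  \<comment> \<open>Subtracting \<open>det(T0)B\<close> makes the partner isotropic and keeps the
    pairing with \<open>B\<close>, because
    \<open>\<langle>B, B\<rangle> = 2 det B = 0\<close>.\<close>
  define T where "T = add2 R T0 (smult2 R (\<ominus> det2 R T0) B)"
  have T: "T \<in> matrices2 R" "polar2 R B T = \<one>" "det2 R T = \<zero>"
    using T0 BM by (simp_all add: T_def polar2_add_smult polar2_self detB det2_add_smult
        polar2_commute[of T0 B] r_neg)
  obtain F where F: "F \<in> matrices2 R" "det2 R F = \<zero>" "polar2 R (Mat2 \<one> \<zero> \<zero> \<one>) F = \<one>"
    "mult2 R B F = Mat2 \<zero> \<zero> \<zero> \<zero>" "mult2 R T F = T"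
    using hyperbolic_pair_projection[OF BM T(1) detB T(3,2)] by blast
  define C1 where "C1 = mult2 R C0 F"
  define h where "h = \<one> \<oplus> polar2 R A C1"
  define C where "C = add2 R C1 (smult2 R (\<ominus> h) T)"
  have C1: "C1 \<in> matrices2 R" "det2 R C1 = \<zero>"
    using C0 F by (simp_all add: C1_def det2_mult2)
  \<comment> \<open>Both arguments are right multiples of the singular matrix \<open>F\<close>,
    hence orthogonal.\<close>
  have "polar2 R C1 T = polar2 R (mult2 R C0 F) (mult2 R T F)"
    by (simp add: C1_def F(5))
  then have C1T: "polar2 R C1 T = \<zero>"
    using C0 F(1,2) T(1) by (simp add: polar2_mult2)
  have h: "h \<in> carrier R"
    using A C1 by (simp add: h_def)
  \<comment> \<open>Since \<open>BF = 0\<close>, the shift of \<open>A\<close> by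
    \<open>d C1\<close> is singular. Expanding its determinant gives \<open>dh = 0\<close>.\<close>
  have "d \<oplus> d \<otimes> polar2 R A C1 = det2 R (add2 R A (smult2 R d C1))"
    using A C1 d by (simp add: det2_add_smult d_def)
  also have "\<dots> = \<zero>"
    unfolding C1_def using A C0 d F(1-3) by (rule det2_add_smult_mult2) (use F(4) B_def in simp)
  finally have hd: "h \<otimes> d = \<zero>"
    using A C1 d by (simp add: h_def m_comm[of _ d] r_distr)
  \<comment> \<open>Expanding \<open>\<langle>B, T\<rangle> = 1\<close> and multiplying by
    \<open>h\<close> kills the term with \<open>d\<close>, so
    \<open>h\<langle>A, T\<rangle> = h\<close>. Subtracting \<open>hT\<close> from \<open>C1\<close>
    thus lowers the pairing with \<open>A\<close> by exactly \<open>h\<close>.\<close>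
  have "\<one> = polar2 R A T \<oplus> d \<otimes> polar2 R C0 T"
    using A C0 T(1) d unfolding T(2)[symmetric] B_def
    by (simp add: polar2_commute[of _ T] polar2_add_smult)
  then have "h = h \<otimes> (polar2 R A T \<oplus> d \<otimes> polar2 R C0 T)"
    using h by (metis r_one)
  also have "\<dots> = h \<otimes> polar2 R A T \<oplus> (h \<otimes> d) \<otimes> polar2 R C0 T"
    using h d A C0 T(1) by (simp add: r_distr m_assoc)
  finally have hAT: "h \<otimes> polar2 R A T = h"
    using h A C0 T(1) by (simp add: hd)
  have "polar2 R A C = polar2 R A C1 \<ominus> h \<otimes> polar2 R A T"
    using A C1 T h by (simp add: C_def polar2_add_smult l_minus a_minus_def)
  also have "\<dots> = polar2 R A C1 \<ominus> (\<one> \<oplus> polar2 R A C1)"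
    unfolding hAT by (simp add: h_def)
  also have "\<dots> = \<ominus> \<one>"
    using A C1 by (simp add: expand_simps)
  finally have "polar2 R A C = \<ominus> \<one>" .
  moreover have "C \<in> matrices2 R" "det2 R C = \<zero>"
    using C1 C1T T h by (simp_all add: C_def det2_add_smult)
  ultimately show thesis
    using that by blast
qed

lemma Um_mat2_if_polar2_uminus_one:
  assumes "A \<in> matrices2 R" "C \<in> matrices2 R" "polar2 R A C = \<ominus> \<one>"
  shows "A \<in> Um_mat2 R"
proof -
  have "polar2 R A (smult2 R (\<ominus> \<one>) C) = \<ominus> \<one> \<otimes> polar2 R A C"
    using assms(1,2) by (cases A; cases C) (simp add: expand_simps)
  then have "polar2 R A (smult2 R (\<ominus> \<one>) C) = \<one>"
    by (simp add: assms(3) l_minus)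
  then show ?thesis
    using assms(1,2) by (auto simp: Um_mat2_iff intro!: bexI[of _ "smult2 R (\<ominus> \<one>) C"])
qed

text \<open>The linear term of the determinant cancels \<open>det A\<close>, and the quadratic term
  vanishes. As \<open>\<langle>C, C\<rangle> = 2 det C = 0\<close>, the shift leaves the pairing
  with \<open>C\<close> at \<open>-1\<close>, which certifies unimodularity.\<close>

lemma simple_extension_shift:
  assumes A: "A \<in> matrices2 R" and C: "C \<in> matrices2 R" "det2 R C = \<zero>" "polar2 R A C = \<ominus> \<one>"
  shows "C \<in> Um_mat2 R" "add2 R A (smult2 R (det2 R A) C) \<in> Um_mat2 R"
    "det2 R (add2 R A (smult2 R (det2 R A) C)) = \<zero>"
proof -
  show "C \<in> Um_mat2 R"
    using Um_mat2_if_polar2_uminus_one[of C A] assms by (simp add: polar2_commute)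
  show "det2 R (add2 R A (smult2 R (det2 R A) C)) = \<zero>"
    using assms by (simp add: det2_add_smult r_minus r_neg)
  have "polar2 R (add2 R A (smult2 R (det2 R A) C)) C = \<ominus> \<one>"
    using assms by (simp add: polar2_commute[of _ C] polar2_add_smult polar2_self)
  then show "add2 R A (smult2 R (det2 R A) C) \<in> Um_mat2 R"
    using A C(1) by (intro Um_mat2_if_polar2_uminus_one[of _ C]) auto
qed

section \<open>Congruences modulo the determinant as shifts\<close>

lemma cong_mod2_PIdl_iff:
  assumes "A \<in> matrices2 R" "B \<in> matrices2 R" "k \<in> carrier R"
  shows "cong_mod2 R (PIdl k) B A \<longleftrightarrow> (\<exists>C \<in> matrices2 R. B = add2 R A (smult2 R k C))"
proof -
  have eq: "y \<ominus> x \<in> PIdl k \<longleftrightarrow> (\<exists>r \<in> carrier R. y = x \<oplus> k \<otimes> r)"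
    if "x \<in> carrier R" "y \<in> carrier R" for x y
  proof -
    have "y \<ominus> x \<in> PIdl k \<longleftrightarrow> (\<exists>r \<in> carrier R. y \<ominus> x = k \<otimes> r)"
      using assms(3) by (auto simp: cgenideal_def m_comm)
    also have "\<dots> \<longleftrightarrow> (\<exists>r \<in> carrier R. y = x \<oplus> k \<otimes> r)"
      using that assms(3) by (intro bex_cong) (simp_all add: minus_eq_iff a_comm)
    finally show ?thesis .
  qed
  obtain a b c d a' b' c' d' where AB: "A = Mat2 a b c d" "B = Mat2 a' b' c' d'"
    by (cases A; cases B)
  show ?thesis
  proof
    assume "cong_mod2 R (PIdl k) B A"
    then obtain r s t u where "r \<in> carrier R" "s \<in> carrier R" "t \<in> carrier R" "u \<in> carrier R"
      "a' = a \<oplus> k \<otimes> r" "b' = b \<oplus> k \<otimes> s" "c' = c \<oplus> k \<otimes> t" "d' = d \<oplus> k \<otimes> u"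
      using assms by (auto simp: cong_mod2_def AB eq)
    then show "\<exists>C \<in> matrices2 R. B = add2 R A (smult2 R k C)"
      by (intro bexI[of _ "Mat2 r s t u"]) (simp_all add: AB)
  next
    assume "\<exists>C \<in> matrices2 R. B = add2 R A (smult2 R k C)"
    then obtain C where C: "C \<in> matrices2 R" "B = add2 R A (smult2 R k C)" by blast
    obtain r s t u where Ceq: "C = Mat2 r s t u" by (cases C)
    show "cong_mod2 R (PIdl k) B A"
      using assms C by (auto simp: cong_mod2_def AB Ceq eq)
  qed
qed

text \<open>The matrix \<open>C\<close> collects the entrywise quotients of \<open>B - A\<close> by
  \<open>det A\<close>; it is required to be neither unimodular nor singular.\<close>

lemma Z2_ring_iff_shift:
  "Z2_ring R \<longleftrightarrow>
     (\<forall>A \<in> Um_mat2 R. \<exists>C \<in> matrices2 R.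
        add2 R A (smult2 R (det2 R A) C) \<in> Um_mat2 R \<and>
        det2 R (add2 R A (smult2 R (det2 R A) C)) = \<zero>)"
proof -
  have "(\<exists>B \<in> Um_mat2 R. cong_mod2 R (PIdl (det2 R A)) B A \<and> det2 R B = \<zero>) \<longleftrightarrow>
      (\<exists>C \<in> matrices2 R. add2 R A (smult2 R (det2 R A) C) \<in> Um_mat2 R \<and>
        det2 R (add2 R A (smult2 R (det2 R A) C)) = \<zero>)" if "A \<in> Um_mat2 R" for A
  proof -
    have "A \<in> matrices2 R"
      using that by (simp add: Um_mat2_iff)
    moreover have "B \<in> matrices2 R" if "B \<in> Um_mat2 R" for B
      using that by (simp add: Um_mat2_iff)
    ultimately show ?thesis
      using cong_mod2_PIdl_iff[of A _ "det2 R A"] by (smt (verit) det2_closed)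
  qed
  then show ?thesis
    unfolding Z2_ring_def by simp
qed

text \<open>The arbitrary shift supplied by the \<open>Z2_ring\<close> property is traded for a
  singular \<open>C\<close> pairing to \<open>-1\<close> with \<open>A\<close>.\<close>

lemma Z2_ring_imp_shift:
  assumes "Z2_ring R" "A \<in> Um_mat2 R"
  shows "\<exists>C \<in> Um_mat2 R. add2 R A (smult2 R (det2 R A) C) \<in> Um_mat2 R \<and>
    det2 R C = \<zero> \<and> det2 R (add2 R A (smult2 R (det2 R A) C)) = \<zero>"
proof -
  have A: "A \<in> matrices2 R"
    using assms(2) by (simp add: Um_mat2_iff)
  obtain C0 where "C0 \<in> matrices2 R" "add2 R A (smult2 R (det2 R A) C0) \<in> Um_mat2 R"
    "det2 R (add2 R A (smult2 R (det2 R A) C0)) = \<zero>"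
    using assms unfolding Z2_ring_iff_shift by blast
  then obtain C where "C \<in> matrices2 R" "det2 R C = \<zero>" "polar2 R A C = \<ominus> \<one>"
    using simple_extension_exists[OF A] by blast
  then show ?thesis
    using simple_extension_shift[OF A] by blast
qed

end

section \<open>Reduction modulo a principal ideal\<close>

context ring_hom_cring
begin

lemma map_mat2_closed: "A \<in> matrices2 R \<Longrightarrow> map_mat2 h A \<in> matrices2 S"
  by (cases A) simp

lemma det2_map_mat2: "A \<in> matrices2 R \<Longrightarrow> det2 S (map_mat2 h A) = h (det2 R A)"
  by (cases A) (simp add: a_minus_def)

lemma polar2_map_mat2:
  "\<lbrakk>A \<in> matrices2 R; B \<in> matrices2 R\<rbrakk> \<Longrightarrow>
     polar2 S (map_mat2 h A) (map_mat2 h B) = h (polar2 R A B)"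
  by (cases A; cases B) (simp add: a_minus_def)

text \<open>A homomorphism carries a partner \<open>T\<close> with
  \<open>\<langle>A, T\<rangle> = 1\<close> to a partner of the image.\<close>

lemma map_mat2_Um_det_zero:
  assumes "A \<in> Um_mat2 R" "h (det2 R A) = \<zero>\<^bsub>S\<^esub>"
  shows "map_mat2 h A \<in> Um_det_zero S"
proof -
  obtain T where "A \<in> matrices2 R" "T \<in> matrices2 R" "polar2 R A T = \<one>"
    using assms(1) by (auto simp: R.Um_mat2_iff)
  then show ?thesis
    using assms(2) polar2_map_mat2[of A T] map_mat2_closed[of A] map_mat2_closed[of T]
    by (auto simp: Um_det_zero_def S.Um_mat2_iff det2_map_mat2)
qed

end

context cring
begin

lemma quotient_ring_hom_cring:
  assumes "a \<in> carrier R"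
  shows "ring_hom_cring R (R Quot (PIdl a)) ((+>) (PIdl a))"
  using cgenideal_ideal[OF assms] is_cring by (rule ideal.rcos_ring_hom_cring)

lemma quotient_zero_iff:
  assumes "a \<in> carrier R" "x \<in> carrier R"
  shows "PIdl a +> x = \<zero>\<^bsub>R Quot (PIdl a)\<^esub> \<longleftrightarrow> x \<in> PIdl a"
  using assms cgenideal_ideal[OF assms(1)] quotient_eq_iff_same_a_r_cos[of "PIdl a" x \<zero>]
  by (simp add: FactRing_def a_rcos_zero a_minus_def)
    (metis a_coset_add_zero additive_subgroup.a_subset ideal.axioms(1))

lemma reduce2_eq_iff:
  assumes "a \<in> carrier R" "A \<in> matrices2 R" "B \<in> matrices2 R"
  shows "reduce2 R a B = reduce2 R a A \<longleftrightarrow> cong_mod2 R (PIdl a) B A"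
  using assms quotient_eq_iff_same_a_r_cos[OF cgenideal_ideal[OF assms(1)]]
  by (cases A; cases B) (simp add: reduce2_def cong_mod2_def)

lemma reduce2_surj:
  assumes "M \<in> matrices2 (R Quot (PIdl a))"
  obtains A where "A \<in> matrices2 R" "reduce2 R a A = M"
proof -
  obtain p q r s where M: "M = Mat2 p q r s" by (cases M)
  have "\<exists>x \<in> carrier R. PIdl a +> x = y" if "y \<in> carrier (R Quot (PIdl a))" for y
    using that by (auto simp: FactRing_def A_RCOSETS_def')
  then obtain x y z w where "x \<in> carrier R" "y \<in> carrier R" "z \<in> carrier R" "w \<in> carrier R"
    "PIdl a +> x = p" "PIdl a +> y = q" "PIdl a +> z = r" "PIdl a +> w = s"
    using assms by (auto simp: M) metis
  then show thesis
    by (intro that[of "Mat2 x y z w"]) (simp_all add: M reduce2_def)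
qed

lemma reduce2_Um_det_zero:
  assumes "a \<in> carrier R" "A \<in> Um_mat2 R" "det2 R A \<in> PIdl a"
  shows "reduce2 R a A \<in> Um_det_zero (R Quot (PIdl a))"
proof -
  interpret q: ring_hom_cring R "R Quot (PIdl a)" "(+>) (PIdl a)"
    using assms(1) by (rule quotient_ring_hom_cring)
  show ?thesis
    using assms q.map_mat2_Um_det_zero[of A]
    by (simp add: reduce2_def quotient_zero_iff Um_mat2_iff)
qed

text \<open>Modulo its own determinant, \<open>A\<close> becomes singular, so surjectivity for
  \<open>a = det A\<close> yields \<open>B\<close>. If \<open>det A = 0\<close>, a modulus outside
  the hypothesis, \<open>A\<close> itself serves as \<open>B\<close>.\<close>

lemma Z2_ring_if_reduce2_surj:
  assumes "\<forall>a \<in> carrier R - {\<zero>}. reduce2 R a ` Um_det_zero R = Um_det_zero (R Quot (PIdl a))"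
  shows "Z2_ring R"
  unfolding Z2_ring_def
proof
  fix A assume A: "A \<in> Um_mat2 R"
  then have AM: "A \<in> matrices2 R"
    by (simp add: Um_mat2_iff)
  let ?d = "det2 R A"
  have d: "?d \<in> carrier R"
    using AM by simp
  show "\<exists>B \<in> Um_mat2 R. cong_mod2 R (PIdl ?d) B A \<and> det2 R B = \<zero>"
  proof (cases "?d = \<zero>")
    case True
    moreover have "cong_mod2 R (PIdl ?d) A A"
      using reduce2_eq_iff[OF d AM AM] by simp
    ultimately show ?thesis
      using A by blast
  next
    case False
    then have "reduce2 R ?d A \<in> reduce2 R ?d ` Um_det_zero R"
      using assms d reduce2_Um_det_zero[OF d A cgenideal_self[OF d]] by simp
    then obtain B where B: "B \<in> Um_mat2 R" "det2 R B = \<zero>" "reduce2 R ?d B = reduce2 R ?d A"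
      by (auto simp: Um_det_zero_def)
    then show ?thesis
      using reduce2_eq_iff[OF d AM, of B] by (blast dest: Um_mat2_iff[THEN iffD1])
  qed
qed

section \<open>Stable range: passage to longer tuples and attainment\<close>

definition stable_range_property :: "nat \<Rightarrow> bool" where
  "stable_range_property n \<longleftrightarrow>
     (\<forall>as b. as @ [b] \<in> Um_tuples R (n + 1) \<longrightarrow>
        (\<exists>rs. length rs = n \<and> set rs \<subseteq> carrier R \<and>
           map2 (\<lambda>a r. a \<oplus> b \<otimes> r) as rs \<in> Um_tuples R n))"

text \<open>
  If \<open>1 = ya + zb + w\<close> with \<open>w\<close> in the ideal generated by the remaining entries, those entries can
  be shifted by multiples of \<open>ya + zb\<close>; modulo \<open>a\<close> these are shifts by multiples of \<open>b\<close>.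
\<close>

lemma stable_range_property_Suc:
  assumes n: "stable_range_property n"
  shows "stable_range_property (Suc n)"
  unfolding stable_range_property_def
proof (intro allI impI)
  fix as' b assume "as' @ [b] \<in> Um_tuples R (Suc n + 1)"
  moreover from this obtain as a where as': "as' = as @ [a]"
    by (cases as' rule: rev_cases) (auto simp: Um_tuples_def)
  ultimately have len: "length as = n" and carr: "set as \<subseteq> carrier R" "a \<in> carrier R" "b \<in> carrier R"
    and one: "\<one> \<in> Idl (insert a (insert b (set as)))"
    by (auto simp: Um_tuples_def generates_unit_ideal_iff insert_commute)
  obtain y z w where yzw: "y \<in> carrier R" "z \<in> carrier R" "w \<in> Idl (set as)"
    "\<one> = y \<otimes> a \<oplus> (z \<otimes> b \<oplus> w)"
    using one carr by (auto simp: mem_genideal_insert_iff)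
  have w: "w \<in> carrier R"
    using yzw(3) ideal.Icarr[OF genideal_ideal[OF carr(1)]] by blast
  define t where "t = y \<otimes> a \<oplus> z \<otimes> b"
  have t: "t \<in> carrier R"
    using yzw carr by (simp add: t_def)
  have "\<one> = \<one> \<otimes> t \<oplus> w"
    using yzw(1,2) w carr t unfolding yzw(4) by (simp add: t_def a_assoc flip: yzw(4))
  then have "\<one> \<in> Idl (insert t (set as))"
    unfolding mem_genideal_insert_iff[OF t carr(1)] using yzw(3) one_closed by blast
  then have "as @ [t] \<in> Um_tuples R (n + 1)"
    using len carr(1) t by (auto simp: Um_tuples_def generates_unit_ideal_iff)
  then obtain rs where rs: "length rs = n" "set rs \<subseteq> carrier R"
    "map2 (\<lambda>a r. a \<oplus> t \<otimes> r) as rs \<in> Um_tuples R n"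
    using n unfolding stable_range_property_def by blast
  \<comment> \<open>The final shift \<open>\<zero>\<close> keeps \<open>a\<close> itself in the new
    tuple, so that multiples of \<open>a\<close> can be added back.\<close>
  define rs' where "rs' = map ((\<otimes>) z) rs @ [\<zero>]"
  define G where "G = map2 (\<lambda>a r. a \<oplus> b \<otimes> r) as' rs'"
  have G: "G = map2 (\<lambda>a r. a \<oplus> b \<otimes> (z \<otimes> r)) as rs @ [a]"
    using rs(1) len carr by (simp add: G_def as' rs'_def zip_map2 case_prod_unfold)
  have mem: "x \<in> carrier R" "r \<in> carrier R" if "(x, r) \<in> set (zip as rs)" for x r
    using that carr(1) rs(2) by (auto dest: set_zip_leftD set_zip_rightD)
  have G_carr: "set G \<subseteq> carrier R"
    using mem yzw carr by (auto simp: G)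
  interpret J: ideal "Idl (set G)" R
    using G_carr by (rule genideal_ideal)
  have "x \<oplus> t \<otimes> r \<in> Idl (set G)" if xr: "(x, r) \<in> set (zip as rs)" for x r
  proof -
    have "x \<oplus> b \<otimes> (z \<otimes> r) \<in> Idl (set G)" "a \<in> Idl (set G)"
      using xr genideal_self[OF G_carr] by (force simp: G)+
    \<comment> \<open>Splitting \<open>t\<close> into its two summands shows that each old entry
      lies in the ideal of the new tuple.\<close>
    moreover have "x \<oplus> t \<otimes> r = (x \<oplus> b \<otimes> (z \<otimes> r)) \<oplus> (y \<otimes> r) \<otimes> a"
      using mem[OF xr] yzw carr by (simp add: t_def expand_simps)
    ultimately show ?thesis
      using mem[OF xr] yzw(1) by (auto intro!: J.a_closed J.I_l_closed)
  qed
  then have "set (map2 (\<lambda>a r. a \<oplus> t \<otimes> r) as rs) \<subseteq> Idl (set G)"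
    by auto
  then have "Idl (set (map2 (\<lambda>a r. a \<oplus> t \<otimes> r) as rs)) \<subseteq> Idl (set G)"
    using J.is_ideal by (intro genideal_minimal)
  moreover have "\<one> \<in> Idl (set (map2 (\<lambda>a r. a \<oplus> t \<otimes> r) as rs))"
    using rs(3) by (simp only: Um_tuples_def generates_unit_ideal_iff mem_Collect_eq)
  ultimately have "G \<in> Um_tuples R (Suc n)"
    using G_carr rs(1) len by (auto simp: Um_tuples_def generates_unit_ideal_iff G)
  moreover have "length rs' = Suc n" "set rs' \<subseteq> carrier R"
    using rs yzw by (auto simp: rs'_def)
  ultimately show "\<exists>rs. length rs = Suc n \<and> set rs \<subseteq> carrier R \<and>
      map2 (\<lambda>a r. a \<oplus> b \<otimes> r) as' rs \<in> Um_tuples R (Suc n)"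
    unfolding G_def by blast
qed

lemma stable_range_property_mono:
  "\<lbrakk>m \<le> n; stable_range_property m\<rbrakk> \<Longrightarrow> stable_range_property n"
  by (induction n rule: dec_induct) (auto intro: stable_range_property_Suc)

text \<open>A finite bound makes the defining set nonempty, so its infimum is attained; monotonicity
  then reaches \<open>n\<close>.\<close>

lemma stable_range_le_imp_property:
  assumes "stable_range R \<le> enat n"
  shows "stable_range_property n"
proof -
  let ?N = "{n. n \<ge> 1 \<and> stable_range_property n}"
  have sr: "stable_range R = Inf (enat ` ?N)"
    by (simp add: stable_range_def stable_range_property_def)
  have "?N \<noteq> {}"
    using assms unfolding sr by (fastforce simp: Inf_enat_def)
  then have "Inf (enat ` ?N) \<in> enat ` ?N"
    by (metis (no_types, lifting) Inf_enat_def LeastI_ex ex_in_conv image_is_empty)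
  then show ?thesis
    using assms stable_range_property_mono unfolding sr by auto
qed

section \<open>Lifting unimodular matrices and singular ones\<close>

lemma reduce2_Um_lift:
  assumes sr: "stable_range_property 4" and a: "a \<in> carrier R"
    and M: "M \<in> Um_mat2 (R Quot (PIdl a))"
  obtains A where "A \<in> Um_mat2 R" "reduce2 R a A = M"
proof -
  interpret q: ring_hom_cring R "R Quot (PIdl a)" "(+>) (PIdl a)"
    using a by (rule quotient_ring_hom_cring)
  obtain U where U: "M \<in> matrices2 (R Quot (PIdl a))" "U \<in> matrices2 (R Quot (PIdl a))"
    "polar2 (R Quot (PIdl a)) M U = \<one>\<^bsub>R Quot (PIdl a)\<^esub>"
    using M by (auto simp: q.S.Um_mat2_iff)
  obtain A where A: "A \<in> matrices2 R" "reduce2 R a A = M"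
    using reduce2_surj[OF U(1)] .
  obtain T where T: "T \<in> matrices2 R" "reduce2 R a T = U"
    using reduce2_surj[OF U(2)] .
  \<comment> \<open>Lifts \<open>A\<close> and \<open>T\<close> of a dual pair satisfy
    \<open>\<langle>A, T\<rangle> = 1\<close> only modulo \<open>a\<close>, so the four entries of
    \<open>A\<close> together with \<open>a\<close> form a unimodular 5-tuple.\<close>
  have "PIdl a +> polar2 R A T = PIdl a +> \<one>"
    using q.polar2_map_mat2[OF A(1) T(1)] U(3) A(2) T(2) by (simp add: reduce2_def)
  then have "\<one> \<ominus> polar2 R A T \<in> PIdl a"
    using A(1) T(1) quotient_eq_iff_same_a_r_cos[OF cgenideal_ideal[OF a], of \<one> "polar2 R A T"]
    by simp
  then obtain r where r: "r \<in> carrier R" "\<one> \<ominus> polar2 R A T = r \<otimes> a"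
    by (auto simp: cgenideal_def)
  then have one: "\<one> = r \<otimes> a \<oplus> polar2 R A T"
    using A(1) T(1) a by (simp add: minus_eq_iff)
  obtain x y z w where Aeq: "A = Mat2 x y z w" by (cases A)
  obtain x' y' z' w' where Teq: "T = Mat2 x' y' z' w'" by (cases T)
  have carr: "{x, y, z, w, a} \<subseteq> carrier R"
    using A(1) a by (auto simp: Aeq)
  interpret J: ideal "Idl {x, y, z, w, a}" R
    using carr by (rule genideal_ideal)
  have "r \<otimes> a \<in> Idl {x, y, z, w, a}"
    using genideal_self[OF carr] r(1) by (auto intro!: J.I_l_closed)
  moreover have "polar2 R A T \<in> Idl {x, y, z, w, a}"
    using genideal_self[OF carr] T(1)
    by (auto simp: Aeq Teq a_minus_def intro!: J.a_closed J.a_inv_closed J.I_r_closed)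
  ultimately have "\<one> \<in> Idl {x, y, z, w, a}"
    unfolding one by (rule J.a_closed)
  then have "[x, y, z, w] @ [a] \<in> Um_tuples R (4 + 1)"
    using carr by (simp add: Um_tuples_def generates_unit_ideal_iff)
  then obtain rs where rs: "length rs = 4" "set rs \<subseteq> carrier R"
    "map2 (\<lambda>e r. e \<oplus> a \<otimes> r) [x, y, z, w] rs \<in> Um_tuples R 4"
    using sr unfolding stable_range_property_def by blast
  obtain r1 r2 r3 r4 where rs_eq: "rs = [r1, r2, r3, r4]"
    using rs(1) by (auto simp: numeral_eq_Suc length_Suc_conv)
  define C where "C = Mat2 r1 r2 r3 r4"
  \<comment> \<open>The shifts are multiples of \<open>a\<close>, so they make the lift unimodular
    without changing its reduction.\<close>
  define A' where "A' = add2 R A (smult2 R a C)"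
  have C: "C \<in> matrices2 R" and A'M: "A' \<in> matrices2 R"
    using rs(2) A(1) a by (simp_all add: C_def A'_def rs_eq)
  moreover have "A' \<in> Um_mat2 R"
    using rs(3) A'M by (simp add: A'_def C_def Aeq rs_eq Um_tuples_def Um_mat2_def)
  moreover have "reduce2 R a A' = reduce2 R a A"
    using A(1) A'M C a by (auto simp: reduce2_eq_iff cong_mod2_PIdl_iff A'_def)
  ultimately show thesis
    using that A(2) by simp
qed

lemma reduce2_surj_if_Z2_ring:
  assumes sr: "stable_range_property 4" and Z2: "Z2_ring R" and a: "a \<in> carrier R"
  shows "reduce2 R a ` Um_det_zero R = Um_det_zero (R Quot (PIdl a))"
proof
  interpret q: ring_hom_cring R "R Quot (PIdl a)" "(+>) (PIdl a)"
    using a by (rule quotient_ring_hom_cring)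
  interpret I: ideal "PIdl a" R
    using a by (rule cgenideal_ideal)
  show "reduce2 R a ` Um_det_zero R \<subseteq> Um_det_zero (R Quot (PIdl a))"
    using reduce2_Um_det_zero[OF a] by (auto simp: Um_det_zero_def)
  show "Um_det_zero (R Quot (PIdl a)) \<subseteq> reduce2 R a ` Um_det_zero R"
  proof
    fix M assume "M \<in> Um_det_zero (R Quot (PIdl a))"
    then have M: "M \<in> Um_mat2 (R Quot (PIdl a))" "det2 (R Quot (PIdl a)) M = \<zero>\<^bsub>R Quot (PIdl a)\<^esub>"
      by (simp_all add: Um_det_zero_def)
    obtain A where A: "A \<in> Um_mat2 R" "reduce2 R a A = M"
      using reduce2_Um_lift[OF sr a M(1)] .
    then have AM: "A \<in> matrices2 R"
      by (simp add: Um_mat2_iff)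
    then have "det2 R A \<in> PIdl a"
      using A(2) M(2) q.det2_map_mat2[OF AM] quotient_zero_iff[OF a, of "det2 R A"]
      by (simp add: reduce2_def)
    \<comment> \<open>Because \<open>det A\<close> lies in \<open>Ra\<close>, the correction modulo
      \<open>det A\<close> is invisible modulo \<open>a\<close>.\<close>
    then have "PIdl (det2 R A) \<subseteq> PIdl a"
      using I.is_ideal by (intro cgenideal_minimal)
    moreover obtain B where B: "B \<in> Um_mat2 R" "det2 R B = \<zero>" "cong_mod2 R (PIdl (det2 R A)) B A"
      using Z2 A(1) unfolding Z2_ring_def by blast
    ultimately have "cong_mod2 R (PIdl a) B A"
      by (auto simp: cong_mod2_def elim!: mat2.rel_mono_strong)
    then have "reduce2 R a B = M"
      using reduce2_eq_iff[OF a AM, of B] B(1) A(2) by (auto simp: Um_mat2_iff)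
    then show "M \<in> reduce2 R a ` Um_det_zero R"
      using B by (auto simp: Um_det_zero_def)
  qed
qed

end

theorem theorem1p8:
  fixes R :: "('a, 'm) ring_scheme" (structure)
  assumes "cring R"
  shows "(Z2_ring R \<longleftrightarrow>
            (\<forall>A \<in> Um_mat2 R. \<exists>C \<in> Um_mat2 R.
               add2 R A (smult2 R (det2 R A) C) \<in> Um_mat2 R \<and>
               det2 R C = \<zero> \<and> det2 R (add2 R A (smult2 R (det2 R A) C)) = \<zero>)) \<and>
         (Z2_ring R \<longleftrightarrow>
            (\<forall>A \<in> Um_mat2 R. \<exists>C \<in> matrices2 R.
               add2 R A (smult2 R (det2 R A) C) \<in> Um_mat2 R \<and>
               det2 R C = \<zero> \<and> det2 R (add2 R A (smult2 R (det2 R A) C)) = \<zero>)) \<and>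
         ((\<forall>a \<in> carrier R - {\<zero>}.
             reduce2 R a ` Um_det_zero R = Um_det_zero (R Quot (PIdl a))) \<longrightarrow> Z2_ring R) \<and>
         (stable_range R \<le> 4 \<longrightarrow>
            (Z2_ring R \<longleftrightarrow>
             (\<forall>a \<in> carrier R - {\<zero>}.
                reduce2 R a ` Um_det_zero R = Um_det_zero (R Quot (PIdl a)))))"
proof -
  interpret cring R by fact
  have shift: "Z2_ring R" if "\<forall>A \<in> Um_mat2 R. \<exists>C \<in> matrices2 R.
      add2 R A (smult2 R (det2 R A) C) \<in> Um_mat2 R \<and>
      det2 R C = \<zero> \<and> det2 R (add2 R A (smult2 R (det2 R A) C)) = \<zero>"
    unfolding Z2_ring_iff_shift using that by blast
  \<comment> \<open>This inclusion weakens the condition with unimodular \<open>C\<close> to the one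
    with arbitrary \<open>C\<close>; \<open>shift\<close> leads back to
    \<open>Z2_ring R\<close>.\<close>
  have "Um_mat2 R \<subseteq> matrices2 R"
    by (auto simp: Um_mat2_def)
  moreover have "reduce2 R a ` Um_det_zero R = Um_det_zero (R Quot (PIdl a))"
    if "stable_range R \<le> 4" "Z2_ring R" "a \<in> carrier R - {\<zero>}" for a
    using that stable_range_le_imp_property[of 4] reduce2_surj_if_Z2_ring by (auto simp: numeral_eq_enat)
  ultimately show ?thesis
    using Z2_ring_imp_shift shift Z2_ring_if_reduce2_surj by (smt (verit, ccfv_threshold) subsetD)
qed

end
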